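(* Let $F$ be the complete graph on the vertex set $\{0,1\}^2\setminus\{11\}=\{00,01,10\}$ (i.e. its edges are $\{00,01\},\{00,10\},\{01,10\}$). Then $$C_M(F)=\log_2 \alpha\approx 0.878,$$ where $\alpha^{-1}$ is the unique positive root of the equation $x+x^2+x^3=1$.
   Context: Let $G$ be a simple graph whose vertex set is $\{0,1\}^2$, the set of ordered pairs of binary symbols (written as strings $ab$), or a subset of it, and whose edges are unordered pairs of distinct vertices. Two sequences $\mathbf{x}=(x_1,\dots,x_n),\mathbf{y}=(y_1,\dots,y_n)\in\{0,1\}^n$ are called distinguishable for $G$ if there exists $i\in\{1,\dots,n-1\}$ such that $\{x_ix_{i+1},\,y_iy_{i+1}\}$ is an edge of $G$. Let $M(G,n)$ be the largest cardinality of a set $C\subseteq\{0,1\}^n$ any two distinct elements of which are distinguishable for $G$. The Shannon–Markov capacity of $G$ is $C_M(G)=\limsup_{n\to\infty}\frac1n\log_2 M(G,n)$.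
   Formalization: The value log_2 α is in fact 0.8791..., so "≈ 0.878" is off in the third decimal; the approximation is stated as |log_2 α − 0.878| < 0.002. *)

theory Defs
  imports "HOL-Analysis.Analysis"
begin

text \<open>
  Binary symbols are booleans (\<^term>\<open>False\<close> is 0, \<^term>\<open>True\<close> is 1); a graph is a pair of a
  vertex set and a set of edges.
\<close>

type_synonym pair_graph = "(bool \<times> bool) set \<times> (bool \<times> bool) set set"

definition simple_graph :: "pair_graph \<Rightarrow> bool" where
  "simple_graph G \<longleftrightarrow>
     (\<forall>e\<in>snd G. \<exists>u v. u \<in> fst G \<and> v \<in> fst G \<and> u \<noteq> v \<and> e = {u, v})"

definition complete_graph :: "(bool \<times> bool) set \<Rightarrow> pair_graph" where
  "complete_graph V = (V, {{u, v} | u v. u \<in> V \<and> v \<in> V \<and> u \<noteq> v})"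

lemma simple_graph_complete_graph: "simple_graph (complete_graph V)"
  unfolding simple_graph_def complete_graph_def by auto

text \<open>Lists are indexed from 0, so the admissible positions are those with \<^term>\<open>Suc i < length x\<close>.\<close>

definition distinguishable :: "pair_graph \<Rightarrow> bool list \<Rightarrow> bool list \<Rightarrow> bool" where
  "distinguishable G x y \<longleftrightarrow>
     (\<exists>i. Suc i < length x \<and> {(x ! i, x ! Suc i), (y ! i, y ! Suc i)} \<in> snd G)"

definition max_code :: "pair_graph \<Rightarrow> nat \<Rightarrow> nat" where
  "max_code G n =
     Max {card C | C. C \<subseteq> {x. length x = n} \<and> pairwise (distinguishable G) C}"

text \<open>
  The maximum is taken over a finite nonempty set and is at least 1, so neither \<^const>\<open>Max\<close>
  nor the logarithm below is applied outside its domain.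
\<close>

lemma finite_code_sizes:
  "finite {card C | C. C \<subseteq> {x :: bool list. length x = n} \<and> pairwise R C}"
proof -
  have "finite {x :: bool list. length x = n}"
    using finite_lists_length_eq[of "UNIV :: bool set" n] by simp
  then have "finite (card ` Pow {x :: bool list. length x = n})"
    by simp
  then show ?thesis
    by (rule rev_finite_subset) auto
qed

lemma max_code_ge_1: "1 \<le> max_code G n"
  unfolding max_code_def
proof (rule Max_ge[OF finite_code_sizes], safe)
  show "\<exists>C. 1 = card C \<and> C \<subseteq> {x. length x = n} \<and> pairwise (distinguishable G) C"
    by (rule exI[of _ "{replicate n False}"]) simp
qed

definition Shannon_Markov_capacity :: "pair_graph \<Rightarrow> ereal" where
  "Shannon_Markov_capacity G =
     limsup (\<lambda>n. ereal (1 / real n * log 2 (real (max_code G n))))"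

definition graph_F :: pair_graph where
  "graph_F = complete_graph (UNIV - {(True, True)})"

end

theory Submission imports Defs "HOL-Real_Asymp.Real_Asymp" begin

text \<open>
  Up to constant factors, \<open>M(F,n)\<close> is the number of binary words of length \<open>n\<close> without three
  consecutive ones, which satisfies the tribonacci recursion.

  Lower bound: if two such words are padded by a zero on both sides, then at the first position
  where they differ they continue either as 00, 01 (after a common 0) or, after a common 1, as
  \<open>0b\<close> and 10, since 11 would complete a run of three ones. Either way they are distinguishable.

  Upper bound: erase the interior ones of every run of ones. The result has no three consecutive
  ones, and every pair \<open>x\<^sub>i x\<^sub>i\<^sub>+\<^sub>1\<close> other than 11 survives unchanged, so this map is injective on codes.
\<close>

section \<open>Binary words without three consecutive ones and their number\<close>

definition no_three_ones :: "bool list \<Rightarrow> bool" where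
  "no_three_ones x \<longleftrightarrow>
     (\<forall>i. Suc (Suc i) < length x \<longrightarrow> \<not> (x ! i \<and> x ! Suc i \<and> x ! Suc (Suc i)))"

definition three_ones_free_words :: "nat \<Rightarrow> bool list set" where
  "three_ones_free_words n = {x. length x = n \<and> no_three_ones x}"

lemma no_three_ones_Cons:
  "no_three_ones (a # x) \<longleftrightarrow>
     no_three_ones x \<and> (Suc 0 < length x \<longrightarrow> \<not> (a \<and> x ! 0 \<and> x ! Suc 0))"
proof -
  have "(\<forall>i. P i) \<longleftrightarrow> P 0 \<and> (\<forall>i. P (Suc i))" for P :: "nat \<Rightarrow> bool"
    by (metis not0_implies_Suc)
  from this[of "\<lambda>i. Suc (Suc i) < length (a # x) \<longrightarrow>
      \<not> ((a # x) ! i \<and> (a # x) ! Suc i \<and> (a # x) ! Suc (Suc i))"]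
  show ?thesis
    unfolding no_three_ones_def by auto
qed

lemma no_three_ones_simps [simp]:
  "no_three_ones []"
  "no_three_ones (False # x) = no_three_ones x"
  "no_three_ones [a]"
  "no_three_ones [a, b]"
  "no_three_ones (a # False # x) = no_three_ones x"
  "no_three_ones (True # True # b # x) \<longleftrightarrow> \<not> b \<and> no_three_ones x"
  by (cases b; simp add: no_three_ones_Cons no_three_ones_def[of "[]"])+

lemma finite_three_ones_free_words: "finite (three_ones_free_words n)"
proof (rule finite_subset)
  show "finite {x :: bool list. set x \<subseteq> UNIV \<and> length x = n}"
    by (rule finite_lists_length_eq) simp
qed (auto simp: three_ones_free_words_def)

text \<open>Split by the position of the first zero, which occurs among the first three letters;
  what follows it is unconstrained by the prefix.\<close>

lemma three_ones_free_words_rec: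
  "three_ones_free_words (Suc (Suc (Suc n))) =
     (#) False ` three_ones_free_words (Suc (Suc n)) \<union>
     ((\<lambda>x. True # False # x) ` three_ones_free_words (Suc n) \<union>
      (\<lambda>x. True # True # False # x) ` three_ones_free_words n)" (is "?L = ?R")
proof
  show "?L \<subseteq> ?R"
  proof
    fix x assume x: "x \<in> ?L"
    then obtain a b c y where [simp]: "x = a # b # c # y"
      by (auto simp: three_ones_free_words_def length_Suc_conv)
    show "x \<in> ?R"
      using x by (cases a; cases b) (auto simp: three_ones_free_words_def)
  qed
qed (auto simp: three_ones_free_words_def)

lemma card_three_ones_free_words_rec:
  "card (three_ones_free_words (Suc (Suc (Suc n)))) =
     card (three_ones_free_words (Suc (Suc n))) + card (three_ones_free_words (Suc n)) +
     card (three_ones_free_words n)"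
proof -
  let ?A = "(#) False ` three_ones_free_words (Suc (Suc n))"
  let ?B = "(\<lambda>x. True # False # x) ` three_ones_free_words (Suc n)"
  let ?C = "(\<lambda>x. True # True # False # x) ` three_ones_free_words n"
  have "card (?A \<union> (?B \<union> ?C)) = card ?A + card (?B \<union> ?C)"
    by (rule card_Un_disjoint) (auto simp: finite_three_ones_free_words)
  also have "card (?B \<union> ?C) = card ?B + card ?C"
    by (rule card_Un_disjoint) (auto simp: finite_three_ones_free_words)
  finally show ?thesis
    unfolding three_ones_free_words_rec by (simp add: card_image inj_on_def)
qed

lemma card_three_ones_free_words_base:
  "card (three_ones_free_words 0) = 1"
  "card (three_ones_free_words (Suc 0)) = 2"
  "card (three_ones_free_words (Suc (Suc 0))) = 4"
proof -
  have "three_ones_free_words 0 = {[]}"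
    by (auto simp: three_ones_free_words_def)
  then show "card (three_ones_free_words 0) = 1" by simp
  have "three_ones_free_words (Suc 0) = {[True], [False]}"
    by (auto simp: three_ones_free_words_def length_Suc_conv)
  then show "card (three_ones_free_words (Suc 0)) = 2" by simp
  have "three_ones_free_words (Suc (Suc 0)) =
      {[True, True], [True, False], [False, True], [False, False]}"
    by (auto simp: three_ones_free_words_def length_Suc_conv)
  then show "card (three_ones_free_words (Suc (Suc 0))) = 4" by simp
qed

text \<open>The powers of \<open>\<alpha>\<close> satisfy the same recursion as the cardinalities,
  so both bounds propagate from the initial values 1, 2, 4. The range of \<open>\<alpha>\<close>
  serves these base cases, notably \<open>2 \<le> \<alpha> ^ 2 \<le> 4\<close>.\<close>

lemma card_three_ones_free_words_bounds:
  fixes \<alpha> :: real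
  assumes "\<alpha> ^ 3 = \<alpha> ^ 2 + \<alpha> + 1" "3/2 \<le> \<alpha>" "\<alpha> \<le> 2"
  shows "\<alpha> ^ n \<le> card (three_ones_free_words n) \<and>
         card (three_ones_free_words n) \<le> 2 * \<alpha> ^ n"
proof (induction n rule: less_induct)
  case (less n)
  have sq: "2 \<le> \<alpha> ^ 2" "\<alpha> ^ 2 \<le> 4"
    using power_mono[of "3/2" \<alpha> 2] power_mono[of \<alpha> 2 2] assms
    by (auto simp: power2_eq_square)
  consider "n = 0" | "n = Suc 0" | "n = Suc (Suc 0)" | m where "n = Suc (Suc (Suc m))"
    by (metis not0_implies_Suc)
  then show ?case
  proof cases
    case (4 m)
    have "\<alpha> ^ n = \<alpha> ^ m * \<alpha> ^ 3"
      by (simp add: 4 power3_eq_cube)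
    also have "\<dots> = \<alpha> ^ Suc (Suc m) + \<alpha> ^ Suc m + \<alpha> ^ m"
      unfolding assms(1) by (simp add: algebra_simps power2_eq_square)
    finally show ?thesis
      using less.IH[of m] less.IH[of "Suc m"] less.IH[of "Suc (Suc m)"]
      unfolding 4 card_three_ones_free_words_rec by (simp del: power_Suc)
  qed (use sq assms in \<open>auto simp: card_three_ones_free_words_base power2_eq_square\<close>)
qed

section \<open>Upper bound on codes: erasing interior ones\<close>

lemma distinguishable_graph_F:
  "distinguishable graph_F x y \<longleftrightarrow>
     (\<exists>i. Suc i < length x \<and> (x ! i, x ! Suc i) \<noteq> (y ! i, y ! Suc i) \<and>
        \<not> (x ! i \<and> x ! Suc i) \<and> \<not> (y ! i \<and> y ! Suc i))"
proof -
  have "{p, q} \<in> snd graph_F \<longleftrightarrow> p \<noteq> q \<and> p \<noteq> (True, True) \<and> q \<noteq> (True, True)" for p q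
    unfolding graph_F_def complete_graph_def
    by (cases p; cases q) (auto simp: doubleton_eq_iff)
  then show ?thesis
    unfolding distinguishable_def by simp
qed

text \<open>All neighbours are read in the original word, so the erasures are simultaneous. The
  index guards keep a one at either end of the word, where a neighbour is missing.\<close>

definition erase_interior_ones :: "bool list \<Rightarrow> bool list" where
  "erase_interior_ones x = map (\<lambda>i. x ! i \<and>
     \<not> (0 < i \<and> Suc i < length x \<and> x ! (i - 1) \<and> x ! Suc i)) [0..<length x]"

text \<open>Erasing creates no ones, so the middle of three surviving ones would have had ones on
  both sides in \<open>x\<close> and been erased.\<close>

lemma erase_interior_ones_in_words:
  "erase_interior_ones x \<in> three_ones_free_words (length x)"
  unfolding three_ones_free_words_def no_three_ones_def erase_interior_ones_def by simp

text \<open>Zeros never change, and a one in such a pair has the other letter, a zero, as a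
  neighbour, so it is not interior.\<close>

lemma erase_interior_ones_pair:
  assumes "Suc i < length x" "\<not> (x ! i \<and> x ! Suc i)"
  shows "erase_interior_ones x ! i = x ! i"
    "erase_interior_ones x ! Suc i = x ! Suc i"
  using assms by (auto simp: erase_interior_ones_def)

lemma erase_interior_ones_neq:
  assumes "length x = length y" "distinguishable graph_F x y"
  shows "erase_interior_ones x \<noteq> erase_interior_ones y"
proof -
  obtain i where "Suc i < length x" "(x ! i, x ! Suc i) \<noteq> (y ! i, y ! Suc i)"
    "\<not> (x ! i \<and> x ! Suc i)" "\<not> (y ! i \<and> y ! Suc i)"
    using assms(2) unfolding distinguishable_graph_F by blast
  then show ?thesis
    using erase_interior_ones_pair[of i x] erase_interior_ones_pair[of i y] assms(1) by auto
qed

lemma max_code_graph_F_le: "max_code graph_F n \<le> card (three_ones_free_words n)"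
  unfolding max_code_def
proof (subst Max_le_iff[OF finite_code_sizes])
  show "{card C |C. C \<subseteq> {x. length x = n} \<and> pairwise (distinguishable graph_F) C} \<noteq> {}"
    by (auto intro: exI[of _ "{}"])
  have "card C \<le> card (three_ones_free_words n)"
    if C: "C \<subseteq> {x. length x = n}" "pairwise (distinguishable graph_F) C" for C
  proof (rule card_inj_on_le[of erase_interior_ones])
    show "inj_on erase_interior_ones C"
    proof (rule inj_onI, rule ccontr)
      fix x y
      assume xy: "x \<in> C" "y \<in> C" "erase_interior_ones x = erase_interior_ones y" "x \<noteq> y"
      then have "length x = length y" "distinguishable graph_F x y"
        using C by (auto simp: pairwise_def)
      with xy(3) show False
        using erase_interior_ones_neq by blast
    qed
    show "erase_interior_ones ` C \<subseteq> three_ones_free_words n"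
      using C(1) erase_interior_ones_in_words by auto
  qed (rule finite_three_ones_free_words)
  then show "\<forall>a\<in>{card C |C. C \<subseteq> {x. length x = n} \<and> pairwise (distinguishable graph_F) C}.
      a \<le> card (three_ones_free_words n)"
    by auto
qed

section \<open>Lower bound on codes: words padded by zeros\<close>

lemma distinguishable_of_no_three_ones:
  assumes "length x = length y" "x \<noteq> y" "x ! 0 = y ! 0" "last x = last y"
    "no_three_ones x" "no_three_ones y"
  shows "distinguishable graph_F x y"
proof -
  define i where "i = (LEAST i. i < length x \<and> x ! i \<noteq> y ! i)"
  have ex: "\<exists>i. i < length x \<and> x ! i \<noteq> y ! i"
    using assms(1,2) nth_equalityI by blast
  have i: "i < length x" "x ! i \<noteq> y ! i"
    using LeastI_ex[OF ex] by (auto simp: i_def)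
  have least: "x ! j = y ! j" if "j < i" for j
    using not_less_Least[of j "\<lambda>i. i < length x \<and> x ! i \<noteq> y ! i"] that i(1)
    by (auto simp: i_def)
  obtain j where j: "i = Suc j"
    using i(2) assms(3) by (cases i) auto
  \<comment> \<open>Equal last letters keep the first difference \<open>i\<close> off the last
    position, so the pair starting at \<open>i\<close> exists.\<close>
  have "x ! (length x - 1) = y ! (length x - 1)"
    using assms(1,4) i(1) by (metis last_conv_nth length_0_conv less_nat_zero_code)
  with i have i': "Suc i < length x"
    by (metis Suc_lessI diff_Suc_1)
  have prev: "x ! j = y ! j" using least j by simp
  show ?thesis
  proof (cases "x ! j")
    \<comment> \<open>The common zero at \<open>j\<close> prevents 11 in both words, so the pair at
      \<open>j\<close> distinguishes them.\<close>
    case False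
    then show ?thesis
      unfolding distinguishable_graph_F using i prev j by auto
  next
    \<comment> \<open>Now the pair at \<open>j\<close> is 11 in one of the words, so the pair at
      \<open>i\<close> is used instead.\<close>
    case True
    then have "\<not> (x ! i \<and> x ! Suc i)" "\<not> (y ! i \<and> y ! Suc i)"
      using assms(1,5,6) i' prev unfolding no_three_ones_def j by auto
    then show ?thesis
      unfolding distinguishable_graph_F using i i' by auto
  qed
qed

lemma no_three_ones_snoc_False: "no_three_ones x \<Longrightarrow> no_three_ones (x @ [False])"
  unfolding no_three_ones_def by (auto simp: nth_append)

lemma max_code_graph_F_ge: "card (three_ones_free_words n) \<le> max_code graph_F (Suc (Suc n))"
proof -
  let ?pad = "\<lambda>x. False # x @ [False]"
  let ?C = "?pad ` three_ones_free_words n"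
  have "pairwise (distinguishable graph_F) ?C"
    by (auto simp: pairwise_def three_ones_free_words_def no_three_ones_snoc_False
        intro!: distinguishable_of_no_three_ones)
  moreover have "?C \<subseteq> {x. length x = Suc (Suc n)}"
    by (auto simp: three_ones_free_words_def)
  ultimately have "card ?C \<le> max_code graph_F (Suc (Suc n))"
    unfolding max_code_def by (intro Max_ge[OF finite_code_sizes]) auto
  moreover have "card ?C = card (three_ones_free_words n)"
    by (rule card_image) (simp add: inj_on_def)
  ultimately show ?thesis by simp
qed

section \<open>The capacity as a limit\<close>

lemma Shannon_Markov_capacity_graph_F:
  fixes \<alpha> :: real
  assumes "\<alpha> ^ 3 = \<alpha> ^ 2 + \<alpha> + 1" "3/2 \<le> \<alpha>" "\<alpha> \<le> 2"
  shows "Shannon_Markov_capacity graph_F = ereal (log 2 \<alpha>)"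
proof -
  note bounds = card_three_ones_free_words_bounds[OF assms]
  define r where "r n = 1 / real n * log 2 (real (max_code graph_F n))" for n
  have pos: "0 < real (max_code graph_F n)" for n
    using max_code_ge_1[of graph_F n] by linarith
  \<comment> \<open>For \<open>n = 0\<close> both sides are 0, since division by zero gives
    0.\<close>
  have upper: "r n \<le> 1 / real n * (1 + real n * log 2 \<alpha>)" for n
  proof -
    have "real (max_code graph_F n) \<le> 2 * \<alpha> ^ n"
      using bounds[of n] max_code_graph_F_le[of n] by linarith
    then have "log 2 (real (max_code graph_F n)) \<le> log 2 (2 * \<alpha> ^ n)"
      using pos[of n] by (intro log_mono) auto
    also have "\<dots> = 1 + real n * log 2 \<alpha>"
      using assms by (simp add: log_mult log_nat_power)
    finally show ?thesis
      unfolding r_def by (intro mult_left_mono) auto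
  qed
  have lower: "1 / real n * ((real n - 2) * log 2 \<alpha>) \<le> r n" if "2 \<le> n" for n
  proof -
    obtain m where m: "n = Suc (Suc m)"
      using \<open>2 \<le> n\<close> by (metis add_2_eq_Suc le_Suc_ex)
    have "(real n - 2) * log 2 \<alpha> = log 2 (\<alpha> ^ m)"
      using assms by (simp add: m log_nat_power)
    also have "\<dots> \<le> log 2 (real (max_code graph_F n))"
      using bounds[of m] max_code_graph_F_ge[of m] assms unfolding m
      by (intro log_mono) auto
    finally show ?thesis
      unfolding r_def by (intro mult_left_mono) auto
  qed
  \<comment> \<open>Both limits below hold for an arbitrary constant \<open>L\<close>: the factor 2
    and the two padding letters cost only O(1/n).\<close>
  obtain L where L: "log 2 \<alpha> = L" by simp
  have "r \<longlonglongrightarrow> log 2 \<alpha>"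
  proof (rule tendsto_sandwich)
    show "(\<lambda>n. 1 / real n * ((real n - 2) * log 2 \<alpha>)) \<longlonglongrightarrow> log 2 \<alpha>"
      unfolding L by real_asymp
    show "(\<lambda>n. 1 / real n * (1 + real n * log 2 \<alpha>)) \<longlonglongrightarrow> log 2 \<alpha>"
      unfolding L by real_asymp
    show "\<forall>\<^sub>F n in sequentially. 1 / real n * ((real n - 2) * log 2 \<alpha>) \<le> r n"
      using lower by (auto simp: eventually_sequentially)
  qed (use upper in \<open>intro always_eventually allI\<close>)
  then show ?thesis
    unfolding Shannon_Markov_capacity_def r_def[symmetric]
    by (intro lim_imp_Limsup) auto
qed

section \<open>The positive root, its uniqueness and the numerical value\<close>

lemma tribonacci_polynomial_less:
  fixes x y :: real
  assumes "0 < x" "x < y"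
  shows "x + x^2 + x^3 < y + y^2 + y^3"
  using assms by (intro add_strict_mono power_strict_mono) auto

theorem theorem1:
  shows "\<exists>\<alpha>::real.
     0 < inverse \<alpha> \<and>
     inverse \<alpha> + (inverse \<alpha>)^2 + (inverse \<alpha>)^3 = 1 \<and>
     (\<forall>x::real. 0 < x \<and> x + x^2 + x^3 = 1 \<longrightarrow> x = inverse \<alpha>) \<and>
     Shannon_Markov_capacity graph_F = ereal (log 2 \<alpha>) \<and>
     \<bar>log 2 \<alpha> - 0.878\<bar> < 0.002"
proof -
  \<comment> \<open>The endpoints are the reciprocals of 1.84 and 1.838, which enclose
    \<open>\<alpha>\<close> closely enough for the numerical estimate.\<close>
  have "\<exists>x::real. 25/46 \<le> x \<and> x \<le> 500/919 \<and> x + x^2 + x^3 = 1"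
    by (intro IVT') (auto intro!: continuous_intros simp: power2_eq_square power3_eq_cube)
  then obtain x :: real where x: "25/46 \<le> x" "x \<le> 500/919" "x + x^2 + x^3 = 1"
    by blast
  then have "0 < x" by simp
  define \<alpha> where "\<alpha> = inverse x"
  have \<alpha>: "919/500 \<le> \<alpha>" "\<alpha> \<le> 46/25" and inv: "inverse \<alpha> = x"
    using x \<open>0 < x\<close> by (auto simp: \<alpha>_def field_simps)
  have "\<alpha> ^ 3 = \<alpha> ^ 3 * (x + x^2 + x^3)"
    using x(3) by simp
  also have "\<dots> = \<alpha> ^ 2 + \<alpha> + 1"
    using \<open>0 < x\<close> unfolding \<alpha>_def by (simp add: field_simps power2_eq_square power3_eq_cube)
  finally have cubic: "\<alpha> ^ 3 = \<alpha> ^ 2 + \<alpha> + 1" .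
  have "y = x" if "0 < y" "y + y^2 + y^3 = 1" for y :: real
    using tribonacci_polynomial_less[of x y] tribonacci_polynomial_less[of y x]
      that x(3) \<open>0 < x\<close> by (cases x y rule: linorder_cases) auto
  moreover have "Shannon_Markov_capacity graph_F = ereal (log 2 \<alpha>)"
    using Shannon_Markov_capacity_graph_F[OF cubic] \<alpha> by simp
  moreover have "\<bar>log 2 \<alpha> - 0.878\<bar> < 0.002"
  proof -
    \<comment> \<open>This yields \<open>log 2 \<alpha> \<ge> 36/41\<close>, and 36/41 exceeds 0.878
      slightly.\<close>
    have "(2::real) ^ 36 \<le> (919/500) ^ 41"
      by (simp add: field_simps)
    also have "\<dots> \<le> \<alpha> ^ 41"
      using \<alpha> by (intro power_mono) auto
    finally have "log 2 (2 ^ 36) \<le> log 2 (\<alpha> ^ 41)"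
      by (intro log_mono) auto
    then have lower: "36 \<le> 41 * log 2 \<alpha>"
      using \<alpha> by (simp only: log_nat_power) simp
    \<comment> \<open>The target 22/25 is exactly 0.878 + 0.002, so strictness is essential
      here.\<close>
    have "\<alpha> ^ 25 \<le> (46/25) ^ 25"
      using \<alpha> by (intro power_mono) auto
    also have "\<dots> < 2 ^ 22"
      by (simp add: field_simps)
    finally have "log 2 (\<alpha> ^ 25) < log 2 (2 ^ 22)"
      using \<alpha> by (subst log_less_cancel_iff) auto
    then have "25 * log 2 \<alpha> < 22"
      using \<alpha> by (simp only: log_nat_power) simp
    with lower show ?thesis
      by (simp add: abs_less_iff)
  qed
  ultimately show ?thesis
    using x(3) \<open>0 < x\<close> unfolding inv[symmetric] by blast
qed

end
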